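(* Let $n$ be a positive integer. Then $$\mathcal{S}^n_+\subseteq\mathcal{SDD}_n^*\subseteq\mathcal{SDB}_n^*\subseteq\mathcal{DD}_n^*.$$
   Context: $\mathbb{S}^n$ denotes the space of real symmetric $n\times n$ matrices with inner product $\langle A,B\rangle:=\operatorname{Trace}(A^TB)$, and $\mathcal{S}^n_+:=\{X\in\mathbb{S}^n\mid d^TXd\ge0\text{ for any }d\in\mathbb{R}^n\}$ is the semidefinite cone. For $\mathcal{K}\subseteq\mathbb{S}^n$, the dual cone is $\mathcal{K}^*:=\{A\in\mathbb{S}^n\mid\langle A,B\rangle\ge0\text{ for any }B\in\mathcal{K}\}$ and the conical hull is $\operatorname{cone}(\mathcal{K}):=\{\sum_{i=1}^k\alpha_iX_i\mid X_i\in\mathcal{K},\ \alpha_i\ge0,\ k\in\mathbb{Z}_{\ge0}\}$, where $\mathbb{Z}_{\ge 0}$ is the set of nonnegative integers (the empty sum is the zero matrix). The sets of diagonally dominant and scaled diagonally dominant matrices are $$\mathcal{DD}_n:=\{A\in\mathbb{S}^n\mid A_{i,i}\ge\sum_{j\ne i}|A_{i,j}|\ (i=1,\ldots,n)\},$$ $$\mathcal{SDD}_n:=\{A\in\mathbb{S}^n\mid DAD\in\mathcal{DD}_n\text{ for some positive diagonal matrix }D\},$$ where a positive diagonal matrix is a diagonal matrix with positive diagonal entries. Let $e_i\in\mathbb{R}^n$ be the $i$th standard basis vector. For $\alpha\in\mathbb{R}$, define $\bar{B}_{i,j}(\alpha):=(e_i+\alpha e_j)(e_i+\alpha e_j)^T$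 and $\bar{\mathcal{B}}(\alpha):=\{\bar{B}_{i,j}(\alpha)\mid 1\le i\le j\le n\}$. Let $\mathcal{H}:=\{\pm1,\ \pm1\pm\sqrt2\}$ (all sign choices, six numbers in total) and $$\mathcal{SDB}_n:=\operatorname{cone}\Bigl(\bigcup_{\alpha\in\mathcal{H}}\bar{\mathcal{B}}(\alpha)\Bigr).$$ *)

theory Defs
  imports "HOL-Analysis.Analysis"
begin

(* The index set {1..n} is rendered by a finite, linearly ordered type; the order is
   needed only for the condition i \<le> j in Bbar_set. *)

type_synonym 'n sqmat = "((real, 'n) vec, 'n) vec"

definition sym_mats :: "'n::finite sqmat set" where
  "sym_mats = {A. transpose A = A}"

definition mat_inner :: "'n::finite sqmat \<Rightarrow> 'n sqmat \<Rightarrow> real" where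
  "mat_inner A B = trace (transpose A ** B)"

definition psd_cone :: "'n::finite sqmat set" where
  "psd_cone = {X \<in> sym_mats. \<forall>d. d \<bullet> (X *v d) \<ge> 0}"

definition dual_cone :: "'n::finite sqmat set \<Rightarrow> 'n sqmat set" where
  "dual_cone K = {A \<in> sym_mats. \<forall>B\<in>K. mat_inner A B \<ge> 0}"

(* The library's cone hull only closes under scaling, not under sums. *)
definition conical_hull :: "'n::finite sqmat set \<Rightarrow> 'n sqmat set" where
  "conical_hull K =
     {(\<Sum>i\<in>{1..k}. \<alpha> i *\<^sub>R X i) | (k::nat) \<alpha> X. \<forall>i\<in>{1..k}. X i \<in> K \<and> \<alpha> i \<ge> 0}"

definition DD :: "'n::finite sqmat set" where
  "DD = {A \<in> sym_mats. \<forall>i. A $ i $ i \<ge> (\<Sum>j\<in>UNIV - {i}. \<bar>A $ i $ j\<bar>)}"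

definition pos_diagonal :: "'n::finite sqmat \<Rightarrow> bool" where
  "pos_diagonal D \<longleftrightarrow> (\<forall>i j. i \<noteq> j \<longrightarrow> D $ i $ j = 0) \<and> (\<forall>i. D $ i $ i > 0)"

definition SDD :: "'n::finite sqmat set" where
  "SDD = {A \<in> sym_mats. \<exists>D. pos_diagonal D \<and> D ** A ** D \<in> DD}"

definition outer_square :: "real^'n \<Rightarrow> 'n sqmat" where
  "outer_square v = (columnvector v :: real^1^'n) ** (rowvector v :: real^'n^1)"

definition Bbar :: "'n::finite \<Rightarrow> 'n \<Rightarrow> real \<Rightarrow> 'n sqmat" where
  "Bbar i j \<alpha> = outer_square (axis i 1 + \<alpha> *\<^sub>R axis j 1)"

definition Bbar_set :: "real \<Rightarrow> 'n::{finite,linorder} sqmat set" where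
  "Bbar_set \<alpha> = {Bbar i j \<alpha> | i j. i \<le> j}"

definition H_set :: "real set" where
  "H_set = {1, -1, 1 + sqrt 2, 1 - sqrt 2, -1 + sqrt 2, -1 - sqrt 2}"

definition SDB :: "'n::{finite,linorder} sqmat set" where
  "SDB = conical_hull (\<Union>\<alpha>\<in>H_set. Bbar_set \<alpha>)"

end

theory Submission
  imports Defs
begin

text \<open>
  All three inclusions come from two facts about rank-one forms. Pairing a symmetric \<open>A\<close> with
  \<open>v v\<^sup>T\<close> gives \<open>v \<bullet> A v\<close>, and for \<open>v = a e\<^sub>i + b e\<^sub>j\<close> only one \<open>2 \<times> 2\<close> principal submatrix of
  \<open>A\<close> is seen.

  The first fact (\<open>mat_inner_DD_nonneg\<close>) is that \<open>A\<close> lies in the dual of \<open>DD\<close> as soon as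
  \<open>2 \<bar>A\<^sub>i\<^sub>j\<bar> \<le> A\<^sub>i\<^sub>i + A\<^sub>j\<^sub>j\<close> for all \<open>i, j\<close>, which says that \<open>A\<close> is nonnegative on the vectors
  \<open>e\<^sub>i \<plusminus> e\<^sub>j\<close>. The elements of the dual of \<open>SDB\<close> have this property because \<open>\<plusminus>1\<close> are among the
  admissible parameters; this is the last inclusion. For the first inclusion, let
  \<open>D B D\<close> be diagonally dominant and \<open>X\<close> positive semidefinite: then
  \<open>\<langle>X, B\<rangle> = \<langle>D\<^sup>-\<^sup>1 X D\<^sup>-\<^sup>1, D B D\<rangle>\<close>, and the congruent matrix \<open>D\<^sup>-\<^sup>1 X D\<^sup>-\<^sup>1\<close> satisfies the
  criterion because \<open>X\<close> is nonnegative on \<open>d\<^sub>i\<^sup>-\<^sup>1 e\<^sub>i \<plusminus> d\<^sub>j\<^sup>-\<^sup>1 e\<^sub>j\<close>.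

  The second fact (\<open>Bbar_in_SDD\<close>) is that each generator \<open>(e\<^sub>i + \<alpha> e\<^sub>j)(e\<^sub>i + \<alpha> e\<^sub>j)\<^sup>T\<close> with
  \<open>\<alpha> \<noteq> 0\<close> is scaled diagonally dominant: multiplying coordinate \<open>i\<close> by \<open>\<bar>\<alpha>\<bar>\<close> gives both
  nonzero coordinates the same absolute value. The middle inclusion follows, since a
  functional that is nonnegative on the generators is nonnegative on their conical hull.
\<close>

section \<open>The trace inner product and rank-one matrices\<close>

lemma sym_mats_nth:
  assumes "A \<in> sym_mats"
  shows "A $ i $ j = A $ j $ i"
  using assms unfolding sym_mats_def
  by (metis (mono_tags, lifting) mem_Collect_eq transpose_def vec_lambda_beta)

lemma mat_inner_eq_sum:
  "mat_inner A B = (\<Sum>i\<in>UNIV. \<Sum>j\<in>UNIV. A $ i $ j * B $ i $ j)"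
proof -
  have "mat_inner A B = (\<Sum>j\<in>UNIV. \<Sum>i\<in>UNIV. A $ i $ j * B $ i $ j)"
    by (simp add: mat_inner_def trace_def matrix_matrix_mult_def transpose_def)
  then show ?thesis
    by (simp add: sum.swap[of "\<lambda>j i. A $ i $ j * B $ i $ j"])
qed

lemma mat_inner_sum_right:
  "mat_inner A (\<Sum>k\<in>S. c k *\<^sub>R X k) = (\<Sum>k\<in>S. c k * mat_inner A (X k))"
proof (induction S rule: infinite_finite_induct)
  case (insert k S)
  then show ?case
    by (simp add: mat_inner_eq_sum sum.distrib sum_distrib_left algebra_simps)
qed (simp_all add: mat_inner_eq_sum)

lemma outer_square_nth: "outer_square v $ i $ j = v $ i * v $ j"
  by (simp add: outer_square_def matrix_matrix_mult_def columnvector_def rowvector_def)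

lemma mat_inner_outer_square: "mat_inner A (outer_square v) = v \<bullet> (A *v v)"
  by (simp add: mat_inner_eq_sum outer_square_nth inner_vec_def matrix_vector_mult_def
      sum_distrib_left mult.assoc mult.left_commute mult.commute)

lemma quadratic_form_two_axes:
  fixes A :: "'n::finite sqmat"
  assumes "A \<in> sym_mats"
  defines "v \<equiv> \<lambda>a b i j. a *\<^sub>R axis i 1 + b *\<^sub>R axis j 1 :: real^'n"
  shows "v a b i j \<bullet> (A *v v a b i j)
    = a\<^sup>2 * A $ i $ i + 2 * a * b * A $ i $ j + b\<^sup>2 * A $ j $ j"
proof -
  have column: "axis k (1::real) \<bullet> (A *v axis l 1) = A $ k $ l" for k l
    by (simp add: inner_axis' matrix_vector_mul_component inner_axis)
  show ?thesis
    using sym_mats_nth[OF assms(1), of j i]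
    by (simp add: v_def matrix_vector_right_distrib scaleR_matrix_vector_assoc[symmetric]
        matrix_vector_mult_scaleR inner_add_left inner_add_right column power2_eq_square
        algebra_simps)
qed

section \<open>A criterion for the dual of the diagonally dominant matrices\<close>

text \<open>
  In \<open>\<langle>A, M\<rangle>\<close> the off-diagonal terms are at least \<open>- \<bar>M\<^sub>i\<^sub>j\<bar> (A\<^sub>i\<^sub>i + A\<^sub>j\<^sub>j) / 2\<close>. By the symmetry
  of \<open>M\<close> these bounds add up to \<open>- \<Sum>\<^sub>i A\<^sub>i\<^sub>i \<Sum>\<^sub>j\<^sub>\<noteq>\<^sub>i \<bar>M\<^sub>i\<^sub>j\<bar>\<close>, which the diagonal of \<open>M\<close> compensates.
  The case \<open>i = j\<close> of the hypothesis says \<open>A\<^sub>i\<^sub>i \<ge> 0\<close>.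
\<close>
lemma mat_inner_DD_nonneg:
  fixes A M :: "'n::finite sqmat"
  assumes A: "\<And>i j. 2 * \<bar>A $ i $ j\<bar> \<le> A $ i $ i + A $ j $ j"
    and M: "M \<in> DD"
  shows "0 \<le> mat_inner A M"
proof -
  have sym: "M $ i $ j = M $ j $ i" for i j
    using M sym_mats_nth unfolding DD_def by blast
  define m where "m i j = (if i = j then - (M $ i $ i) else \<bar>M $ i $ j\<bar>)" for i j
  have m_sym: "m i j = m j i" for i j
    using sym[of i j] by (simp add: m_def)
  have nonneg: "0 \<le> A $ i $ i" for i
    using A[of i i] by simp
  have row: "(\<Sum>j\<in>UNIV. m i j) \<le> 0" for i
  proof -
    have "(\<Sum>j\<in>UNIV. m i j) = m i i + (\<Sum>j\<in>UNIV - {i}. m i j)"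
      by (simp add: sum.remove)
    also have "(\<Sum>j\<in>UNIV - {i}. m i j) = (\<Sum>j\<in>UNIV - {i}. \<bar>M $ i $ j\<bar>)"
      by (rule sum.cong) (auto simp: m_def)
    finally show ?thesis
      using M by (simp add: m_def DD_def)
  qed
  have entry: "- (m i j * (A $ i $ i + A $ j $ j) / 2) \<le> A $ i $ j * M $ i $ j" for i j
  proof (cases "i = j")
    case False
    have "- (A $ i $ j * M $ i $ j) \<le> \<bar>M $ i $ j\<bar> * \<bar>A $ i $ j\<bar>"
      by (metis abs_ge_minus_self abs_mult mult.commute)
    also have "\<dots> \<le> \<bar>M $ i $ j\<bar> * ((A $ i $ i + A $ j $ j) / 2)"
      using A[of i j] by (intro mult_left_mono) auto
    finally show ?thesis
      using False by (simp add: m_def)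
  qed (simp add: m_def)
  have swap: "(\<Sum>i\<in>UNIV. \<Sum>j\<in>UNIV. m i j * A $ j $ j) = (\<Sum>i\<in>UNIV. \<Sum>j\<in>UNIV. m i j * A $ i $ i)"
    by (subst sum.swap) (simp add: m_sym)
  have "(\<Sum>i\<in>UNIV. \<Sum>j\<in>UNIV. m i j * (A $ i $ i + A $ j $ j) / 2)
      = (\<Sum>i\<in>UNIV. \<Sum>j\<in>UNIV. m i j * A $ i $ i)"
    using swap
    by (simp add: sum_divide_distrib[symmetric] distrib_left sum.distrib)
  also have "\<dots> = (\<Sum>i\<in>UNIV. (\<Sum>j\<in>UNIV. m i j) * A $ i $ i)"
    by (simp add: sum_distrib_right)
  also have "\<dots> \<le> 0"
    by (rule sum_nonpos) (rule mult_nonpos_nonneg[OF row nonneg])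
  finally have "0 \<le> (\<Sum>i\<in>UNIV. \<Sum>j\<in>UNIV. - (m i j * (A $ i $ i + A $ j $ j) / 2))"
    by (simp add: sum_negf)
  also have "\<dots> \<le> mat_inner A M"
    unfolding mat_inner_eq_sum by (intro sum_mono entry)
  finally show ?thesis .
qed

lemma pos_diagonal_congruence_nth:
  fixes D B :: "'n::finite sqmat"
  assumes "pos_diagonal D"
  shows "(D ** B ** D) $ i $ j = D $ i $ i * B $ i $ j * D $ j $ j"
proof -
  have D: "D $ k $ l = (if k = l then D $ k $ k else 0)" for k l
    using assms unfolding pos_diagonal_def by auto
  have left: "(D ** B) $ i $ l = D $ i $ i * B $ i $ l" for l
    by (simp add: matrix_matrix_mult_def, subst D, simp add: if_distrib[of "\<lambda>x. x * _"] cong: if_cong)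
  show ?thesis
    by (subst matrix_matrix_mult_def, simp add: left, subst D, simp add: if_distrib[of "\<lambda>x. _ * x"] cong: if_cong)
qed

lemma mat_inner_psd_SDD_nonneg:
  fixes X B :: "'n::finite sqmat"
  assumes X: "X \<in> psd_cone" and B: "B \<in> SDD"
  shows "0 \<le> mat_inner X B"
proof -
  obtain D where D: "pos_diagonal D" and DBD: "D ** B ** D \<in> DD"
    using B unfolding SDD_def by blast
  have pos: "0 < D $ i $ i" for i
    using D by (simp add: pos_diagonal_def)
  have sym: "X \<in> sym_mats" and psd: "\<And>v. 0 \<le> v \<bullet> (X *v v)"
    using X unfolding psd_cone_def by auto
  define Y :: "'n sqmat" where "Y = (\<chi> i j. X $ i $ j / (D $ i $ i * D $ j $ j))"
  have criterion: "2 * \<bar>Y $ i $ j\<bar> \<le> Y $ i $ i + Y $ j $ j" for i j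
  proof -
    have form: "0 \<le> Y $ i $ i + 2 * s * Y $ i $ j + Y $ j $ j" if "s\<^sup>2 = 1" for s
    proof -
      let ?v = "(1 / D $ i $ i) *\<^sub>R axis i 1 + (s / D $ j $ j) *\<^sub>R axis j 1 :: real^'n"
      have "?v \<bullet> (X *v ?v) = Y $ i $ i + 2 * s * Y $ i $ j + Y $ j $ j"
        using that
        by (simp add: quadratic_form_two_axes[OF sym] Y_def power_divide power2_eq_square)
      then show ?thesis
        using psd[of ?v] by simp
    qed
    show ?thesis
      using form[of 1] form[of "-1"] by simp
  qed
  have "mat_inner X B = mat_inner Y (D ** B ** D)"
    unfolding mat_inner_eq_sum pos_diagonal_congruence_nth[OF D] Y_def
    using pos by (intro sum.cong) (simp_all add: less_imp_neq[symmetric])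
  then show ?thesis
    using mat_inner_DD_nonneg[OF criterion DBD] by simp
qed

section \<open>The generators\<close>

text \<open>
  A rank-one matrix \<open>w w\<^sup>T\<close> is diagonally dominant if each nonzero \<open>\<bar>w\<^sub>k\<bar>\<close> is at least the sum of
  the other absolute values. After scaling coordinate \<open>i\<close> by \<open>\<bar>\<alpha>\<bar>\<close>, the vector \<open>e\<^sub>i + \<alpha> e\<^sub>j\<close> has
  at most two nonzero coordinates, of equal absolute value.
\<close>
lemma Bbar_in_SDD:
  fixes i j :: "'n::finite"
  assumes "\<alpha> \<noteq> 0"
  shows "Bbar i j \<alpha> \<in> SDD"
proof -
  define v :: "real^'n" where "v = axis i 1 + \<alpha> *\<^sub>R axis j 1"
  define D :: "'n sqmat" where
    "D = (\<chi> k l. if k = l then (if k = i then \<bar>\<alpha>\<bar> else 1) else 0)"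
  define w where "w k = D $ k $ k * v $ k" for k
  have D: "pos_diagonal D"
    using assms by (simp add: pos_diagonal_def D_def)
  have B: "Bbar i j \<alpha> = outer_square v"
    by (simp add: Bbar_def v_def)
  have entry: "(D ** Bbar i j \<alpha> ** D) $ k $ l = w k * w l" for k l
    by (simp add: pos_diagonal_congruence_nth[OF D] B outer_square_nth w_def)
  have w: "w k = (if k = i then (if i = j then \<bar>\<alpha>\<bar> * (1 + \<alpha>) else \<bar>\<alpha>\<bar>)
      else if k = j then \<alpha> else 0)" for k
    by (auto simp: w_def D_def v_def axis_def)
  have "(\<Sum>l\<in>UNIV - {k}. \<bar>w k * w l\<bar>) \<le> w k * w k" for k
  proof -
    have dominated: "(\<Sum>l\<in>UNIV - {k}. \<bar>w l\<bar>) \<le> \<bar>w k\<bar>" if "w k \<noteq> 0"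
    proof (cases "i = j")
      case True
      with that have "k = i"
        by (simp add: w split: if_splits)
      then have "(\<Sum>l\<in>UNIV - {k}. \<bar>w l\<bar>) = 0"
        using True by (intro sum.neutral) (auto simp: w)
      then show ?thesis
        by simp
    next
      case False
      define k' where "k' = (if k = i then j else i)"
      have k: "k = i \<or> k = j"
        using that by (auto simp: w split: if_splits)
      then have "k' \<in> UNIV - {k}" and "\<And>l. l \<in> UNIV - {k} - {k'} \<Longrightarrow> w l = 0"
        using False by (auto simp: w k'_def)
      then have "(\<Sum>l\<in>UNIV - {k}. \<bar>w l\<bar>) = \<bar>w k'\<bar>"
        by (subst sum.remove[of _ k']) auto
      then show ?thesis
        using k False by (auto simp: w k'_def)
    qed
    have "(\<Sum>l\<in>UNIV - {k}. \<bar>w k * w l\<bar>) = \<bar>w k\<bar> * (\<Sum>l\<in>UNIV - {k}. \<bar>w l\<bar>)"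
      by (simp add: abs_mult sum_distrib_left)
    also have "\<dots> \<le> \<bar>w k\<bar> * \<bar>w k\<bar>"
      using dominated by (cases "w k = 0") (simp_all add: mult_left_mono del: abs_mult_self_eq)
    finally show ?thesis
      by simp
  qed
  then have "D ** Bbar i j \<alpha> ** D \<in> DD"
    by (simp add: DD_def sym_mats_def vec_eq_iff transpose_def entry mult.commute)
  moreover have "Bbar i j \<alpha> \<in> sym_mats"
    by (simp add: B sym_mats_def vec_eq_iff transpose_def outer_square_nth mult.commute)
  ultimately show ?thesis
    using D unfolding SDD_def by blast
qed

lemma H_set_nonzero: "\<alpha> \<in> H_set \<Longrightarrow> \<alpha> \<noteq> 0"
proof -
  have "1 < sqrt (2::real)"
    by simp
  moreover assume "\<alpha> \<in> H_set"
  ultimately show "\<alpha> \<noteq> 0"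
    unfolding H_set_def by (elim insertE) (linarith | simp)+
qed

lemma subset_conical_hull: "K \<subseteq> conical_hull K"
proof
  fix X assume "X \<in> K"
  then show "X \<in> conical_hull K"
    unfolding conical_hull_def
    by (intro CollectI exI[of _ 1] exI[of _ "\<lambda>_. 1"] exI[of _ "\<lambda>_. X"]) simp
qed

lemma dual_cone_conical_hull: "dual_cone (conical_hull K) = dual_cone K"
proof
  show "dual_cone (conical_hull K) \<subseteq> dual_cone K"
    using subset_conical_hull unfolding dual_cone_def by blast
  show "dual_cone K \<subseteq> dual_cone (conical_hull K)"
    unfolding dual_cone_def conical_hull_def
    by (auto simp: mat_inner_sum_right intro!: sum_nonneg)
qed

section \<open>The chain of inclusions\<close>

theorem mainTheorem3:
  shows "(psd_cone :: 'n::{finite,linorder} sqmat set) \<subseteq> dual_cone SDD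
    \<and> dual_cone SDD \<subseteq> (dual_cone SDB :: 'n sqmat set)
    \<and> dual_cone SDB \<subseteq> (dual_cone DD :: 'n sqmat set)"
proof (intro conjI)
  show "(psd_cone :: 'n sqmat set) \<subseteq> dual_cone SDD"
    using mat_inner_psd_SDD_nonneg unfolding dual_cone_def psd_cone_def by blast
  show "dual_cone SDD \<subseteq> (dual_cone SDB :: 'n sqmat set)"
    unfolding SDB_def dual_cone_conical_hull
    using Bbar_in_SDD H_set_nonzero unfolding dual_cone_def Bbar_set_def by blast
  show "dual_cone SDB \<subseteq> (dual_cone DD :: 'n sqmat set)"
  proof
    fix A :: "'n sqmat"
    assume "A \<in> dual_cone SDB"
    then have sym: "A \<in> sym_mats"
      and gen: "\<And>i j \<alpha>. \<alpha> \<in> H_set \<Longrightarrow> i \<le> j \<Longrightarrow> 0 \<le> mat_inner A (Bbar i j \<alpha>)"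
      unfolding SDB_def dual_cone_conical_hull unfolding dual_cone_def Bbar_set_def by blast+
    have form: "mat_inner A (Bbar i j \<alpha>)
        = A $ i $ i + 2 * \<alpha> * A $ i $ j + \<alpha>\<^sup>2 * A $ j $ j" for i j \<alpha>
      using quadratic_form_two_axes[OF sym, of 1 i \<alpha> j]
      by (simp add: Bbar_def mat_inner_outer_square)
    have ordered: "2 * \<bar>A $ i $ j\<bar> \<le> A $ i $ i + A $ j $ j" if "i \<le> j" for i j
      using gen[of 1 i j] gen[of "-1" i j] that by (simp add: form H_set_def)
    have "2 * \<bar>A $ i $ j\<bar> \<le> A $ i $ i + A $ j $ j" for i j
      using ordered[of i j] ordered[of j i] sym_mats_nth[OF sym, of i j] linear[of i j] by auto
    then show "A \<in> dual_cone DD"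
      using mat_inner_DD_nonneg sym unfolding dual_cone_def by blast
  qed
qed

end
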